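(* Let $0<q<1$ and let $k$ be a non-negative integer. Then $$\sum_{n=0}^\infty h_{n+k}(x,y,a,b|q)\frac{t^n}{(q;q)_n}=\widetilde{L}(a,b;\theta_{xy})\left\{\frac{p_k(y,x)\,(xt;q)_\infty}{(xt;q)_k\,(yt;q)_\infty}\right\}.$$
   Context: For complex $c$: $(c;q)_0=1$, $(c;q)_n=\prod_{i=0}^{n-1}(1-cq^i)$, $(c;q)_\infty=\prod_{i=0}^\infty(1-cq^i)$. The $q$-binomial coefficient is $\left[{n\atop k}\right]_q=\dfrac{(q;q)_n}{(q;q)_k(q;q)_{n-k}}$. The Cauchy polynomials are $p_n(x,y)=(x-y)(x-qy)\cdots(x-q^{n-1}y)$, $p_0(x,y)=1$; thus $p_n(y,x)=\prod_{i=0}^{n-1}(y-q^ix)$. The generalized Hahn polynomials are $$h_n(x,y,a,b|q)=\sum_{k=0}^n\left[{n\atop k}\right]_q(-1)^kq^{\binom k2}\,b^k\,(a;q)_k\,p_{n-k}(y,x).$$ The operator $\theta_{xy}$ acts on functions of suitable variables $x$ and $y$ by $$\theta_{xy}\{f(x,y)\}=\frac{f(q^{-1}x,y)-f(x,qy)}{q^{-1}x-y},$$ and $\theta_{xy}^k$ is its $k$-th iterate. The homogeneous $q$-difference operator is $$\widetilde{L}(a,b;\theta_{xy})=\sum_{k=0}^\infty\frac{q^{\binom k2}(a;q)_k}{(q;q)_k}\,(b\,\theta_{xy})^k.$$ *)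

theory Defs
  imports "HOL-Analysis.Infinite_Products"
begin

definition qpoch :: "complex \<Rightarrow> complex \<Rightarrow> nat \<Rightarrow> complex" where
  "qpoch c q n = (\<Prod>i<n. 1 - c * q ^ i)"

definition qpoch_inf :: "complex \<Rightarrow> complex \<Rightarrow> complex" where
  "qpoch_inf c q = prodinf (\<lambda>i. 1 - c * q ^ i)"

definition qbinom :: "complex \<Rightarrow> nat \<Rightarrow> nat \<Rightarrow> complex" where
  "qbinom q n k = qpoch q q n / (qpoch q q k * qpoch q q (n - k))"

definition cauchy_poly :: "complex \<Rightarrow> nat \<Rightarrow> complex \<Rightarrow> complex \<Rightarrow> complex" where
  "cauchy_poly q n x y = (\<Prod>i<n. x - q ^ i * y)"

text \<open>The Cauchy polynomial enters with its arguments swapped, as \<open>p\<^sub>n\<^sub>-\<^sub>k(y, x)\<close>.\<close>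

definition gen_hahn ::
  "complex \<Rightarrow> nat \<Rightarrow> complex \<Rightarrow> complex \<Rightarrow> complex \<Rightarrow> complex \<Rightarrow> complex" where
  "gen_hahn q n x y a b =
     (\<Sum>k\<le>n. qbinom q n k * (-1) ^ k * q ^ (k choose 2) * b ^ k * qpoch a q k
              * cauchy_poly q (n - k) y x)"

text \<open>
  At points with \<open>q\<^sup>-\<^sup>1 x = y\<close> the quotient below has the junk value 0. The value of the
  \<open>k\<close>-th iterate at \<open>(x, y)\<close> involves the points \<open>(q\<^sup>-\<^sup>i x, q\<^sup>j y)\<close> with \<open>i + j \<le> k\<close>, with
  denominators at those with \<open>i + j < k\<close>. Hence all iterates are meaningful at \<open>(x, y)\<close>
  iff \<open>x \<noteq> q\<^sup>m y\<close> for every \<open>m \<ge> 1\<close> (and the function itself is defined at all these points).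
\<close>

definition theta ::
  "complex \<Rightarrow> (complex \<Rightarrow> complex \<Rightarrow> complex) \<Rightarrow> complex \<Rightarrow> complex \<Rightarrow> complex" where
  "theta q f = (\<lambda>x y. (f (inverse q * x) y - f x (q * y)) / (inverse q * x - y))"

definition L_term ::
  "complex \<Rightarrow> complex \<Rightarrow> complex \<Rightarrow> (complex \<Rightarrow> complex \<Rightarrow> complex)
     \<Rightarrow> complex \<Rightarrow> complex \<Rightarrow> nat \<Rightarrow> complex" where
  "L_term q a b f x y k =
     q ^ (k choose 2) * qpoch a q k / qpoch q q k
       * ((\<lambda>g u v. b * theta q g u v) ^^ k) f x y"

definition L_op ::
  "complex \<Rightarrow> complex \<Rightarrow> complex \<Rightarrow> (complex \<Rightarrow> complex \<Rightarrow> complex)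
     \<Rightarrow> complex \<Rightarrow> complex \<Rightarrow> complex" where
  "L_op q a b f = (\<lambda>x y. \<Sum>k. L_term q a b f x y k)"

end

theory Submission
  imports Defs "HOL-Analysis.Infinite_Sum"
begin

text \<open>
  The operator \<open>\<theta>\<close> lowers the index of a Cauchy polynomial, \<open>\<theta> p\<^sub>m(y, x) = -(1 - q\<^sup>m) p\<^sub>m\<^sub>-\<^sub>1(y, x)\<close>
  (\<open>theta_cauchy_poly\<close>). Hence its \<open>j\<close>-th iterate multiplies by \<open>(-1)\<^sup>j (q;q)\<^sub>m / (q;q)\<^sub>m\<^sub>-\<^sub>j\<close> and
  lowers the index by \<open>j\<close>, and the defining sum of \<open>h\<^sub>m\<close> is the operator \<open>L\<close> applied to
  \<open>p\<^sub>m(y, x)\<close>; this is the content of \<open>gen_hahn_sums\<close>.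
  It remains to write the function under the operator as a series in Cauchy polynomials. The
  q-binomial theorem, in the homogeneous form \<open>q_binomial_theorem\<close>, gives
  \<open>\<Sum>\<^sub>n p\<^sub>n\<^sub>+\<^sub>k(y, x) t\<^sup>n / (q;q)\<^sub>n = p\<^sub>k(y, x) (xt;q)\<^sub>\<infinity> / ((xt;q)\<^sub>k (yt;q)\<^sub>\<infinity>)\<close>,
  so applying \<open>L\<close> term by term yields the generating function of \<open>h\<^sub>n\<^sub>+\<^sub>k\<close>.

  Two analytic points have to be settled. An iterate of \<open>\<theta>\<close> at \<open>(x, y)\<close> is a finite combination
  of values at points \<open>(q\<^sup>-\<^sup>i x, q\<^sup>j y)\<close>, so it may be taken under the sum as soon as the expansion
  converges at all of these points and no denominator vanishes there (\<open>theta_iterate_sums\<close>).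
  The remaining interchange of the sums over \<open>n\<close> and \<open>j\<close> is dominated by a geometric series
  in \<open>n\<close> times a series in \<open>j\<close> that converges because of the factor \<open>\<bar>q\<bar>\<close> to the power
  \<open>j choose 2\<close> (\<open>double_series_bound\<close>, \<open>sum_swap_dominated\<close>).
  The argument is carried out for complex \<open>q\<close> with \<open>0 < \<bar>q\<bar> < 1\<close>
  (\<open>gen_hahn_generating_function\<close>).
\<close>

section \<open>Shifted factorials\<close>

lemma qpoch_0 [simp]: "qpoch c q 0 = 1"
  by (simp add: qpoch_def)

lemma qpoch_Suc: "qpoch c q (Suc n) = qpoch c q n * (1 - c * q ^ n)"
  by (simp add: qpoch_def)

lemma qpoch_add: "qpoch c q (k + n) = qpoch c q k * qpoch (c * q ^ k) q n"
  by (induction n) (simp_all add: qpoch_Suc power_add mult_ac)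

lemma qpoch_factor_nonzero:
  fixes c q :: complex
  assumes "norm q < 1" "norm c < 1"
  shows "1 - c * q ^ i \<noteq> 0"
proof
  assume "1 - c * q ^ i = 0"
  then have "norm (c * q ^ i) = 1" by simp
  moreover have "norm c * norm q ^ i \<le> norm c * 1"
    using assms by (intro mult_left_mono power_le_one) auto
  ultimately show False
    using assms by (simp add: norm_mult norm_power)
qed

lemma convergent_prod_qpoch:
  fixes c q :: complex
  assumes "norm q < 1"
  shows "convergent_prod (\<lambda>i. 1 - c * q ^ i)"
proof (intro abs_convergent_prod_imp_convergent_prod summable_imp_abs_convergent_prod)
  have "summable (\<lambda>i. norm c * norm q ^ i)"
    using assms by (intro summable_mult summable_geometric) auto
  then show "summable (\<lambda>i. norm (1 - c * q ^ i - 1))"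
    by (simp add: norm_mult norm_power)
qed

lemma qpoch_tendsto:
  assumes "norm q < 1"
  shows "qpoch c q \<longlonglongrightarrow> qpoch_inf c q"
proof -
  have "(\<lambda>n. qpoch c q (Suc n)) \<longlonglongrightarrow> qpoch_inf c q"
    using convergent_prod_LIMSEQ[OF convergent_prod_qpoch[OF assms, of c]]
    by (simp add: qpoch_def qpoch_inf_def lessThan_Suc_atMost)
  then show ?thesis by (rule LIMSEQ_imp_Suc)
qed

lemma qpoch_nonzero:
  assumes "norm q < 1" "norm c < 1"
  shows "qpoch c q n \<noteq> 0"
  using qpoch_factor_nonzero[OF assms] by (simp add: qpoch_def)

lemma qpoch_inf_nonzero:
  assumes "norm q < 1" "norm c < 1"
  shows "qpoch_inf c q \<noteq> 0"
  unfolding qpoch_inf_def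
  using convergent_prod_qpoch[OF assms(1)] qpoch_factor_nonzero[OF assms]
  by (rule prodinf_nonzero)

text \<open>As the limit of the finite splitting, this holds also when some of the factors vanish.\<close>

lemma qpoch_inf_split:
  assumes "norm q < 1"
  shows "qpoch_inf c q = qpoch c q k * qpoch_inf (c * q ^ k) q"
proof (rule LIMSEQ_unique)
  show "(\<lambda>n. qpoch c q (n + k)) \<longlonglongrightarrow> qpoch_inf c q"
    by (rule LIMSEQ_ignore_initial_segment[OF qpoch_tendsto[OF assms]])
  have "(\<lambda>n. qpoch c q k * qpoch (c * q ^ k) q n) \<longlonglongrightarrow> qpoch c q k * qpoch_inf (c * q ^ k) q"
    by (intro tendsto_mult tendsto_const qpoch_tendsto assms)
  then show "(\<lambda>n. qpoch c q (n + k)) \<longlonglongrightarrow> qpoch c q k * qpoch_inf (c * q ^ k) q"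
    by (simp add: qpoch_add add.commute[of _ k])
qed

lemma qpoch_bounded:
  assumes "norm q < 1"
  obtains B where "B > 0" "\<And>n. norm (qpoch c q n) \<le> B"
proof -
  have "Bseq (qpoch c q)"
    using qpoch_tendsto[OF assms] convergentI convergent_imp_Bseq by blast
  then show ?thesis using that unfolding Bseq_def by blast
qed

text \<open>The limit is nonzero, so the denominators \<open>(q;q)\<^sub>n\<close> cannot spoil convergence.\<close>

lemma qpoch_inverse_bounded:
  assumes "norm q < 1" "norm c < 1"
  obtains B where "B > 0" "\<And>n. norm (inverse (qpoch c q n)) \<le> B"
proof -
  have "(\<lambda>n. inverse (qpoch c q n)) \<longlonglongrightarrow> inverse (qpoch_inf c q)"
    by (intro tendsto_inverse qpoch_tendsto qpoch_inf_nonzero assms)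
  then have "Bseq (\<lambda>n. inverse (qpoch c q n))"
    using convergentI convergent_imp_Bseq by blast
  then show ?thesis using that unfolding Bseq_def by blast
qed


section \<open>Cauchy polynomials and the q-binomial theorem\<close>

lemma cauchy_poly_0 [simp]: "cauchy_poly q 0 x y = 1"
  by (simp add: cauchy_poly_def)

lemma cauchy_poly_Suc: "cauchy_poly q (Suc n) x y = cauchy_poly q n x y * (x - q ^ n * y)"
  by (simp add: cauchy_poly_def)

lemma cauchy_poly_add:
  "cauchy_poly q (k + n) x y = cauchy_poly q k x y * cauchy_poly q n x (q ^ k * y)"
  by (induction n) (simp_all add: cauchy_poly_Suc power_add mult_ac)

text \<open>
  The factors of \<open>p\<^sub>n(y, x)\<close> tend to \<open>y\<close>, so the polynomials grow geometrically at any rate above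
  \<open>\<bar>y\<bar>\<close>. A rate \<open>\<rho> > \<bar>y\<bar>\<close> rather than \<open>\<bar>y\<bar>\<close> itself covers the case \<open>y = 0\<close> as well.
\<close>

lemma cauchy_poly_bounded:
  fixes x y q :: complex
  assumes q: "norm q < 1" and \<rho>: "norm y < \<rho>"
  obtains M where "M > 0" "\<And>n. norm (cauchy_poly q n y x) \<le> M * \<rho> ^ n"
proof -
  have \<rho>0: "\<rho> > 0" using \<rho> norm_ge_zero[of y] by linarith
  (* The bounding product is a finite q-shifted factorial with base |q| and parameter -|x|/rho. *)
  define w where "w = norm x / \<rho>"
  have w: "w \<ge> 0" using \<rho>0 by (simp add: w_def)
  obtain M where M: "M > 0" "\<And>n. norm (qpoch (- of_real w) (of_real (norm q)) n) \<le> M"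
    using qpoch_bounded[of "of_real (norm q)" "- of_real w"] q by auto
  have "norm (cauchy_poly q n y x) \<le> M * \<rho> ^ n" for n
  proof -
    have "norm (cauchy_poly q n y x) = (\<Prod>i<n. norm (y - q ^ i * x))"
      by (simp add: cauchy_poly_def prod_norm)
    also have "\<dots> \<le> (\<Prod>i<n. \<rho> * (1 + w * norm q ^ i))"
    proof (intro prod_mono conjI)
      fix i
      have "norm (y - q ^ i * x) \<le> norm y + norm q ^ i * norm x"
        by (metis norm_mult norm_power norm_triangle_ineq4)
      also have "\<dots> \<le> \<rho> + norm q ^ i * norm x" using \<rho> by simp
      also have "\<dots> = \<rho> * (1 + w * norm q ^ i)" using \<rho>0 by (simp add: w_def field_simps)
      finally show "norm (y - q ^ i * x) \<le> \<rho> * (1 + w * norm q ^ i)" .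
    qed auto
    also have "\<dots> = \<rho> ^ n * (\<Prod>i<n. 1 + w * norm q ^ i)"
      by (simp add: prod.distrib)
    also have "(\<Prod>i<n. 1 + w * norm q ^ i) = norm (qpoch (- of_real w) (of_real (norm q)) n)"
    proof -
      have "qpoch (- of_real w) (of_real (norm q)) n = of_real (\<Prod>i<n. 1 + w * norm q ^ i)"
        by (simp add: qpoch_def)
      moreover have "(\<Prod>i<n. 1 + w * norm q ^ i) \<ge> 0"
        using w by (intro prod_nonneg) auto
      ultimately show ?thesis by (simp only: norm_of_real abs_of_nonneg)
    qed
    also have "\<rho> ^ n * \<dots> \<le> \<rho> ^ n * M"
      using M(2)[of n] \<rho>0 by (intro mult_left_mono) auto
    finally show ?thesis by (simp add: mult.commute)
  qed
  with M(1) show ?thesis using that by blast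
qed

text \<open>
  A growth rate above \<open>\<bar>y\<bar>\<close> that still beats \<open>\<bar>t\<bar>\<close>. Positivity matters for \<open>y = 0\<close>, since the
  rate appears in denominators later on.
\<close>

lemma rate_between:
  fixes y t :: complex
  assumes "norm (y * t) < 1"
  obtains \<rho> where "\<rho> > norm y" "\<rho> > 0" "\<rho> * norm t < 1"
proof (cases "t = 0")
  case True
  have "norm y + 1 > 0" using norm_ge_zero[of y] by linarith
  with True show ?thesis using that[of "norm y + 1"] by simp
next
  case False
  then have "norm y < 1 / norm t" using assms by (simp add: norm_mult field_simps)
  then obtain \<rho> where \<rho>: "norm y < \<rho>" "\<rho> < 1 / norm t" using dense by blast
  moreover have "\<rho> > 0" using \<rho> norm_ge_zero[of y] by linarith
  ultimately show ?thesis using that[of \<rho>] False by (simp add: field_simps)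
qed

lemma summable_cauchy_poly:
  fixes q x y t :: complex
  assumes q: "norm q < 1" and yt: "norm (y * t) < 1"
  shows "summable (\<lambda>n. cauchy_poly q n y x / qpoch q q n * t ^ n)"
proof -
  obtain \<rho> where \<rho>: "\<rho> > norm y" "\<rho> > 0" "\<rho> * norm t < 1" using rate_between[OF yt] by blast
  obtain M where M: "M > 0" "\<And>n. norm (cauchy_poly q n y x) \<le> M * \<rho> ^ n"
    using cauchy_poly_bounded[OF q \<rho>(1), where x = x] by blast
  obtain C where C: "C > 0" "\<And>n. norm (inverse (qpoch q q n)) \<le> C"
    using qpoch_inverse_bounded[OF q q] by blast
  show ?thesis
  proof (rule summable_comparison_test')
    show "summable (\<lambda>n. M * C * (\<rho> * norm t) ^ n)"
      using \<rho> by (intro summable_mult summable_geometric) auto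
    fix n
    have "norm (cauchy_poly q n y x / qpoch q q n * t ^ n)
        = norm (cauchy_poly q n y x) * norm (inverse (qpoch q q n)) * norm t ^ n"
      by (simp add: norm_mult norm_divide norm_power norm_inverse divide_inverse)
    also have "\<dots> \<le> (M * \<rho> ^ n) * C * norm t ^ n"
      using M C \<rho> by (intro mult_right_mono mult_mono) auto
    finally show "norm (cauchy_poly q n y x / qpoch q q n * t ^ n) \<le> M * C * (\<rho> * norm t) ^ n"
      by (simp add: power_mult_distrib mult_ac)
  qed
qed

text \<open>
  The coefficients \<open>c\<^sub>n = p\<^sub>n(y, x) / (q;q)\<^sub>n\<close> satisfy \<open>(1 - q\<^sup>n\<^sup>+\<^sup>1) c\<^sub>n\<^sub>+\<^sub>1 = (y - q\<^sup>n x) c\<^sub>n\<close>, which says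
  that the generating function obeys \<open>G(t) - G(qt) = y t G(t) - x t G(qt)\<close>.
\<close>

lemma q_binomial_functional_equation:
  fixes q x y t :: complex
  defines "G \<equiv> (\<lambda>s. \<Sum>n. cauchy_poly q n y x / qpoch q q n * s ^ n)"
  assumes q: "norm q < 1" and yt: "norm (y * t) < 1"
  shows "(1 - y * t) * G t = (1 - x * t) * G (q * t)"
proof -
  define c where "c = (\<lambda>n. cauchy_poly q n y x / qpoch q q n)"
  have "norm (y * (q * t)) = norm q * norm (y * t)" by (simp add: norm_mult mult_ac)
  also have "\<dots> \<le> 1 * norm (y * t)" using q by (intro mult_right_mono) auto
  finally have yqt: "norm (y * (q * t)) < 1" using yt by simp
  have s1: "(\<lambda>n. c n * t ^ n) sums G t"
    unfolding G_def c_def by (intro summable_sums summable_cauchy_poly q yt)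
  have s2: "(\<lambda>n. c n * (q * t) ^ n) sums G (q * t)"
    unfolding G_def c_def by (intro summable_sums summable_cauchy_poly q yqt)
  have rec: "c (Suc n) * (1 - q ^ Suc n) = c n * (y - q ^ n * x)" for n
    using qpoch_factor_nonzero[OF q q, of n]
    by (simp add: c_def cauchy_poly_Suc qpoch_Suc)
  have "(\<lambda>n. c (Suc n) * t ^ Suc n - c (Suc n) * (q * t) ^ Suc n) sums (G t - G (q * t))"
  proof -
    have "(\<lambda>n. c n * t ^ n - c n * (q * t) ^ n) sums (G t - G (q * t))"
      by (rule sums_diff[OF s1 s2])
    then show ?thesis using sums_Suc_iff[of "\<lambda>n. c n * t ^ n - c n * (q * t) ^ n"] by simp
  qed
  moreover have "c (Suc n) * t ^ Suc n - c (Suc n) * (q * t) ^ Suc n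
      = y * t * (c n * t ^ n) - x * t * (c n * (q * t) ^ n)" for n
  proof -
    have "c (Suc n) * t ^ Suc n - c (Suc n) * (q * t) ^ Suc n
        = (c (Suc n) * (1 - q ^ Suc n)) * t ^ Suc n"
      by (simp add: power_mult_distrib algebra_simps)
    then show ?thesis unfolding rec by (simp add: power_mult_distrib algebra_simps)
  qed
  ultimately have "(\<lambda>n. y * t * (c n * t ^ n) - x * t * (c n * (q * t) ^ n))
      sums (G t - G (q * t))" by simp
  moreover have "(\<lambda>n. y * t * (c n * t ^ n) - x * t * (c n * (q * t) ^ n))
      sums (y * t * G t - x * t * G (q * t))"
    by (intro sums_diff sums_mult s1 s2)
  ultimately have "G t - G (q * t) = y * t * G t - x * t * G (q * t)"
    by (rule sums_unique2)
  then show ?thesis by (simp add: algebra_simps)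
qed

text \<open>
  Iterating the functional equation pushes the argument to \<open>q\<^sup>N t \<rightarrow> 0\<close>, where the generating
  function is continuous with value 1. With \<open>x = a y\<close> this is the classical q-binomial theorem;
  the homogeneous form also makes sense for \<open>y = 0\<close>.
\<close>

theorem q_binomial_theorem:
  fixes q x y t :: complex
  assumes q: "norm q < 1" and yt: "norm (y * t) < 1"
  shows "(\<lambda>n. cauchy_poly q n y x / qpoch q q n * t ^ n) sums (qpoch_inf (x * t) q / qpoch_inf (y * t) q)"
proof -
  define c where "c = (\<lambda>n. cauchy_poly q n y x / qpoch q q n)"
  define G where "G = (\<lambda>s. \<Sum>n. c n * s ^ n)"
  have small: "norm (y * (q ^ N * t)) < 1" for N
  proof -
    have "norm (y * (q ^ N * t)) = norm q ^ N * norm (y * t)"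
      by (simp add: norm_mult norm_power mult_ac)
    also have "\<dots> \<le> 1 * norm (y * t)" using q by (intro mult_right_mono power_le_one) auto
    finally show ?thesis using yt by simp
  qed
  have iter: "qpoch (y * t) q N * G t = qpoch (x * t) q N * G (q ^ N * t)" for N
  proof (induction N)
    case (Suc N)
    have "qpoch (y * t) q (Suc N) * G t = (1 - y * (q ^ N * t)) * (qpoch (y * t) q N * G t)"
      by (simp add: qpoch_Suc mult_ac)
    also have "\<dots> = qpoch (x * t) q N * ((1 - y * (q ^ N * t)) * G (q ^ N * t))"
      unfolding Suc by (simp only: mult_ac)
    also have "(1 - y * (q ^ N * t)) * G (q ^ N * t) = (1 - x * (q ^ N * t)) * G (q * (q ^ N * t))"
      unfolding G_def c_def by (rule q_binomial_functional_equation[OF q small])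
    finally show ?case by (simp add: qpoch_Suc mult_ac)
  qed simp
  (* If t = 0 the series at t says nothing near 0, so a nonzero K inside the disc is needed. *)
  have cont: "isCont G 0"
  proof -
    obtain K :: complex where K: "K \<noteq> 0" "norm (y * K) < 1"
    proof (cases "t = 0")
      case True
      obtain \<rho> where \<rho>: "\<rho> > norm y" "\<rho> > 0" using rate_between[OF yt] by blast
      have "norm (y * of_real (inverse \<rho>)) = norm y / \<rho>"
        using \<rho> by (simp only: norm_mult norm_of_real divide_inverse) simp
      then show ?thesis using that[of "of_real (inverse \<rho>)"] \<rho> by (simp only:) simp
    next
      case False
      then show ?thesis using that yt by blast
    qed
    show ?thesis unfolding G_def c_def
      by (rule isCont_powser[OF summable_cauchy_poly[OF q K(2)]]) (use K in simp)
  qed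
  have "(\<lambda>N. q ^ N * t) \<longlonglongrightarrow> 0 * t"
    by (intro tendsto_mult tendsto_const LIMSEQ_power_zero q)
  then have "(\<lambda>N. G (q ^ N * t)) \<longlonglongrightarrow> G 0"
    using isCont_tendsto_compose[OF cont] by simp
  moreover have "G 0 = 1"
    unfolding G_def using powser_zero[of c] by (simp add: c_def)
  ultimately have "(\<lambda>N. qpoch (x * t) q N * G (q ^ N * t)) \<longlonglongrightarrow> qpoch_inf (x * t) q * 1"
    by (intro tendsto_mult qpoch_tendsto q) simp
  moreover have "(\<lambda>N. qpoch (y * t) q N * G t) \<longlonglongrightarrow> qpoch_inf (y * t) q * G t"
    by (intro tendsto_mult qpoch_tendsto tendsto_const q)
  ultimately have "qpoch_inf (y * t) q * G t = qpoch_inf (x * t) q"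
    unfolding iter using LIMSEQ_unique by fastforce
  then have "G t = qpoch_inf (x * t) q / qpoch_inf (y * t) q"
    using qpoch_inf_nonzero[OF q yt] by (simp add: field_simps)
  moreover have "(\<lambda>n. c n * t ^ n) sums G t"
    unfolding G_def c_def by (intro summable_sums summable_cauchy_poly q yt)
  ultimately show ?thesis by (simp add: c_def)
qed

text \<open>
  Pulling the first \<open>k\<close> factors out of \<open>p\<^sub>n\<^sub>+\<^sub>k(y, x)\<close> leaves \<open>p\<^sub>n(y, q\<^sup>k x)\<close>, and cancelling
  \<open>(xt;q)\<^sub>k\<close> from \<open>(xt;q)\<^sub>\<infinity>\<close> leaves \<open>(q\<^sup>k xt;q)\<^sub>\<infinity>\<close>; so this is the q-binomial theorem at \<open>q\<^sup>k x\<close>.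
\<close>

lemma shifted_q_binomial_theorem:
  fixes q x y t :: complex
  assumes q: "norm q < 1" and yt: "norm (y * t) < 1" and nz: "qpoch (x * t) q k \<noteq> 0"
  shows "(\<lambda>n. t ^ n / qpoch q q n * cauchy_poly q (n + k) y x) sums
    (cauchy_poly q k y x * qpoch_inf (x * t) q / (qpoch (x * t) q k * qpoch_inf (y * t) q))"
proof -
  have "(\<lambda>n. cauchy_poly q k y x * (cauchy_poly q n y (q ^ k * x) / qpoch q q n * t ^ n)) sums
      (cauchy_poly q k y x * (qpoch_inf (q ^ k * x * t) q / qpoch_inf (y * t) q))"
    by (intro sums_mult q_binomial_theorem q yt)
  moreover have "qpoch_inf (x * t) q = qpoch (x * t) q k * qpoch_inf (q ^ k * x * t) q"
    using qpoch_inf_split[OF q, of "x * t" k] by (simp add: mult_ac)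
  ultimately show ?thesis
    using nz by (simp add: cauchy_poly_add add.commute[of _ k] mult_ac)
qed


section \<open>Iterates of the homogeneous q-difference operator\<close>

text \<open>
  Applying \<open>\<theta>\<close> to \<open>p\<^sub>m(y, x)\<close> plays the role of a derivative, so \<open>j\<close> applications produce, up to sign,
  this analogue of the falling factorial \<open>m (m - 1) \<cdots> (m - j + 1)\<close>. For \<open>j > m\<close> the factor at
  \<open>i = m\<close> is \<open>1 - q\<^sup>0 = 0\<close>, so the truncated subtraction does no harm.
\<close>

definition qfalling :: "complex \<Rightarrow> nat \<Rightarrow> nat \<Rightarrow> complex" where
  "qfalling q m j = (\<Prod>i<j. 1 - q ^ (m - i))"

lemma qfalling_0 [simp]: "qfalling q m 0 = 1"
  by (simp add: qfalling_def)

lemma qfalling_Suc: "qfalling q m (Suc j) = qfalling q m j * (1 - q ^ (m - j))"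
  by (simp add: qfalling_def)

lemma qfalling_eq_0: "m < j \<Longrightarrow> qfalling q m j = 0"
  unfolding qfalling_def by (rule prod_zero) (auto intro!: bexI[of _ m])

lemma qfalling_mult_qpoch:
  "j \<le> m \<Longrightarrow> qfalling q m j * qpoch q q (m - j) = qpoch q q m"
proof (induction j)
  case (Suc j)
  then have "m - j = Suc (m - Suc j)" by simp
  then have "qpoch q q (m - j) = qpoch q q (m - Suc j) * (1 - q ^ (m - j))"
    by (simp add: qpoch_Suc)
  with Suc show ?case by (simp add: qfalling_Suc mult_ac)
qed simp

text \<open>
  Both \<open>p\<^sub>m(y, q\<^sup>-\<^sup>1 x)\<close> and \<open>p\<^sub>m(qy, x)\<close> contain \<open>(y - q\<^sup>-\<^sup>1 x) p\<^sub>m\<^sub>-\<^sub>1(y, x)\<close>, with cofactors 1 and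
  \<open>q\<^sup>m\<close>; the common linear factor is minus the denominator of \<open>\<theta>\<close>.
\<close>

lemma theta_cauchy_poly:
  assumes q: "q \<noteq> 0"
  shows "cauchy_poly q m y (inverse q * x) - cauchy_poly q m (q * y) x
       = - (1 - q ^ m) * cauchy_poly q (m - 1) y x * (inverse q * x - y)"
proof (cases m)
  case (Suc n)
  have "q * (inverse q * x) = x" using q by simp
  then have shift: "cauchy_poly q n y (q * (inverse q * x)) = cauchy_poly q n y x" by (rule arg_cong)
  have *: "cauchy_poly q (Suc n) y (inverse q * x) = (y - inverse q * x) * cauchy_poly q n y x"
    using cauchy_poly_add[of q 1 n y "inverse q * x"] unfolding power_one_right shift
    by (simp add: cauchy_poly_def[of q "Suc 0"])
  have "cauchy_poly q m (q * y) x = (\<Prod>i<m. q * (y - q ^ i * (inverse q * x)))" 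
    unfolding cauchy_poly_def using q by (intro prod.cong) (auto simp: algebra_simps)
  also have "\<dots> = q ^ m * cauchy_poly q m y (inverse q * x)"
    by (simp add: prod.distrib cauchy_poly_def)
  finally have "cauchy_poly q m (q * y) x = q ^ m * ((y - inverse q * x) * cauchy_poly q n y x)"
    by (simp only: Suc *)
  moreover have "cauchy_poly q m y (inverse q * x) = (y - inverse q * x) * cauchy_poly q n y x"
    by (simp only: Suc *)
  ultimately show ?thesis by (simp add: Suc algebra_simps)
qed simp

text \<open>
  The induction needs the values at \<open>(q\<^sup>-\<^sup>1 x, y)\<close> and \<open>(x, qy)\<close>, so it runs over all points
  of a set \<open>D\<close> closed under both shifts.
\<close>

lemma theta_iterate_sums:
  fixes c :: "nat \<Rightarrow> complex" and d :: "nat \<Rightarrow> nat"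
  assumes q: "q \<noteq> 0"
    and D_shift: "\<And>x y. (x, y) \<in> D \<Longrightarrow> (inverse q * x, y) \<in> D \<and> (x, q * y) \<in> D"
    and D_nz: "\<And>x y. (x, y) \<in> D \<Longrightarrow> inverse q * x \<noteq> y"
    and F: "\<And>x y. (x, y) \<in> D \<Longrightarrow> (\<lambda>n. c n * cauchy_poly q (d n) y x) sums F x y"
    and D: "(x, y) \<in> D"
  shows "(\<lambda>n. c n * ((- b) ^ j * qfalling q (d n) j * cauchy_poly q (d n - j) y x))
      sums ((\<lambda>g u v. b * theta q g u v) ^^ j) F x y"
  using D
proof (induction j arbitrary: x y)
  case 0
  then show ?case using F by simp
next
  case (Suc j)
  define H where "H = ((\<lambda>g u v. b * theta q g u v) ^^ j) F"
  define e where "e = (\<lambda>n. c n * ((- b) ^ j * qfalling q (d n) j))"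
  have IH: "(\<lambda>n. e n * cauchy_poly q (d n - j) v u) sums H u v" if "(u, v) \<in> D" for u v
    using Suc.IH[OF that] by (simp add: H_def e_def mult_ac)
  have nz: "inverse q * x - y \<noteq> 0" using D_nz[OF Suc.prems] by simp
  have "(\<lambda>n. b * ((e n * cauchy_poly q (d n - j) y (inverse q * x)
             - e n * cauchy_poly q (d n - j) (q * y) x) / (inverse q * x - y)))
      sums (b * ((H (inverse q * x) y - H x (q * y)) / (inverse q * x - y)))"
    using D_shift[OF Suc.prems] by (intro sums_mult sums_divide sums_diff IH) auto
  moreover have "b * ((e n * cauchy_poly q (d n - j) y (inverse q * x)
             - e n * cauchy_poly q (d n - j) (q * y) x) / (inverse q * x - y))
      = c n * ((- b) ^ Suc j * qfalling q (d n) (Suc j) * cauchy_poly q (d n - Suc j) y x)" for n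
  proof -
    have "e n * cauchy_poly q (d n - j) y (inverse q * x) - e n * cauchy_poly q (d n - j) (q * y) x
        = e n * (- (1 - q ^ (d n - j)) * cauchy_poly q (d n - j - 1) y x) * (inverse q * x - y)"
      using theta_cauchy_poly[OF q, of "d n - j" y x]
      by (simp only: right_diff_distrib[symmetric] mult.assoc)
    then have quot: "(e n * cauchy_poly q (d n - j) y (inverse q * x) - e n * cauchy_poly q (d n - j) (q * y) x)
          / (inverse q * x - y) = e n * (- (1 - q ^ (d n - j)) * cauchy_poly q (d n - j - 1) y x)"
      using nz by simp
    show ?thesis unfolding quot by (simp add: e_def qfalling_Suc algebra_simps)
  qed
  ultimately show ?case by (simp add: H_def theta_def)
qed


section \<open>Interchange of summation\<close>

lemma sum_swap_dominated:
  fixes f :: "nat \<Rightarrow> nat \<Rightarrow> complex"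
  assumes bound: "\<And>n j. norm (f n j) \<le> g n * h j"
    and g: "summable g" and h: "summable h"
    and g0: "\<And>n. g n \<ge> 0" and h0: "\<And>j. h j \<ge> 0"
    and A: "\<And>n. f n sums A n" and B: "\<And>j. (\<lambda>n. f n j) sums B j"
  shows "summable A \<and> summable B \<and> suminf A = suminf B"
proof -
  have hs: "(h has_sum suminf h) UNIV"
    using h h0 by (intro sums_nonneg_imp_has_sum summable_sums) auto
  have gs: "g summable_on UNIV" using g g0 by (simp add: summable_on_UNIV_nonneg_real_iff)
  have "(\<lambda>(n, j). g n * h j) summable_on UNIV \<times> UNIV"
  proof (rule summable_on_SigmaI)
    show "((\<lambda>y. case (x, y) of (n, j) \<Rightarrow> g n * h j) has_sum g x * suminf h) UNIV" for x
      using has_sum_cmult_right[OF hs] by simp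
    show "(\<lambda>x. g x * suminf h) summable_on UNIV"
      using gs by (rule summable_on_cmult_left)
  qed (use g0 h0 in auto)
  then have "(\<lambda>p. norm (case p of (n, j) \<Rightarrow> f n j)) summable_on UNIV \<times> UNIV"
    by (rule abs_summable_on_comparison_test') (use bound in auto)
  then have fs: "(\<lambda>(n, j). f n j) summable_on UNIV \<times> UNIV"
    by (rule abs_summable_summable)
  have rowA: "(f n has_sum A n) UNIV" for n
  proof (rule norm_summable_imp_has_sum[OF _ A])
    show "summable (\<lambda>j. norm (f n j))"
      by (rule summable_comparison_test'[OF summable_mult[OF h, of "g n"], of 0]) (simp add: bound)
  qed
  have colB: "((\<lambda>n. f n j) has_sum B j) UNIV" for j
  proof (rule norm_summable_imp_has_sum[OF _ B])
    show "summable (\<lambda>n. norm (f n j))"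
      by (rule summable_comparison_test'[OF summable_mult2[OF g, of "h j"], of 0]) (simp add: bound)
  qed
  obtain S where S: "((\<lambda>(n, j). f n j) has_sum S) (UNIV \<times> UNIV)"
    using fs by (auto simp: summable_on_def)
  have "(A has_sum S) UNIV"
    by (rule has_sum_SigmaD[OF S]) (use rowA in auto)
  moreover have "(B has_sum S) UNIV"
  proof (rule has_sum_SigmaD)
    show "((\<lambda>(j, n). f n j) has_sum S) (UNIV \<times> UNIV)"
      using has_sum_swap[of "\<lambda>(n, j). f n j" UNIV UNIV S] S by (simp only: case_prod_conv split_def fst_conv snd_conv)
  qed (use colB in simp)
  ultimately have "A sums S" "B sums S" by (auto intro: has_sum_imp_sums)
  then show ?thesis by (simp add: sums_iff)
qed

text \<open>
  The ratio of consecutive terms is \<open>r\<^sup>j B\<close>, which tends to 0 for every \<open>B\<close>. This is why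
  the operator series converges for every \<open>b\<close>.
\<close>

lemma summable_q_gauss:
  fixes r B :: real
  assumes "0 \<le> r" "r < 1" "B \<ge> 0"
  shows "summable (\<lambda>j. r ^ (j choose 2) * B ^ j)"
proof -
  have "(\<lambda>j. r ^ j * B) \<longlonglongrightarrow> 0 * B"
    using assms by (intro tendsto_mult tendsto_const LIMSEQ_power_zero) auto
  then have "eventually (\<lambda>j. r ^ j * B < 1 / 2) sequentially"
    by (intro order_tendstoD(2)) auto
  then obtain N where N: "\<And>j. j \<ge> N \<Longrightarrow> r ^ j * B < 1 / 2"
    by (auto simp: eventually_sequentially)
  show ?thesis
  proof (rule summable_ratio_test[of "1 / 2" N])
    fix j assume "j \<ge> N"
    have "Suc j choose 2 = j + (j choose 2)" by (simp add: numeral_2_eq_2)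
    then have "r ^ (Suc j choose 2) * B ^ Suc j = (r ^ j * B) * (r ^ (j choose 2) * B ^ j)"
      by (simp add: power_add mult_ac)
    also have "\<dots> \<le> 1 / 2 * (r ^ (j choose 2) * B ^ j)"
      using N[OF \<open>j \<ge> N\<close>] assms by (intro mult_right_mono) auto
    finally show "norm (r ^ (Suc j choose 2) * B ^ Suc j) \<le> 1 / 2 * norm (r ^ (j choose 2) * B ^ j)"
      using assms by (simp add: abs_mult)
  qed simp
qed


section \<open>The generating function\<close>

text \<open>
  The series is \<open>L\<close> applied to \<open>p\<^sub>m(y, x)\<close>: the q-falling factorial divided by \<open>(q;q)\<^sub>j\<close>
  is the q-binomial coefficient. It is kept as an infinite series, with vanishing terms from
  \<open>j = m + 1\<close> on, so that it can serve as a row of the double series.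
\<close>

lemma gen_hahn_sums:
  fixes q x y a b :: complex
  assumes q: "norm q < 1"
  shows "(\<lambda>j. q ^ (j choose 2) * qpoch a q j / qpoch q q j
            * ((- b) ^ j * qfalling q m j * cauchy_poly q (m - j) y x)) sums gen_hahn q m x y a b"
proof -
  let ?f = "\<lambda>j. q ^ (j choose 2) * qpoch a q j / qpoch q q j
            * ((- b) ^ j * qfalling q m j * cauchy_poly q (m - j) y x)"
  have "?f sums sum ?f {..m}"
    by (rule sums_finite) (auto simp: qfalling_eq_0)
  also have "sum ?f {..m} = gen_hahn q m x y a b"
    unfolding gen_hahn_def
  proof (rule sum.cong)
    fix j assume "j \<in> {..m}"
    then have "qfalling q m j * qpoch q q (m - j) = qpoch q q m"
      by (simp add: qfalling_mult_qpoch)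
    then have "qfalling q m j = qpoch q q m / qpoch q q (m - j)"
      using qpoch_nonzero[OF q q, of "m - j"] by (simp add: field_simps)
    then have "qbinom q m j = qfalling q m j / qpoch q q j"
      by (simp add: qbinom_def mult_ac)
    then show "?f j = qbinom q m j * (-1) ^ j * q ^ (j choose 2) * b ^ j * qpoch a q j
              * cauchy_poly q (m - j) y x"
      by (simp add: power_minus[of b] mult_ac)
  qed simp
  finally show ?thesis .
qed

text \<open>
  With \<open>p\<^sub>n\<^sub>+\<^sub>k\<^sub>-\<^sub>j\<close> of size \<open>\<rho>\<^sup>n\<^sup>+\<^sup>k\<^sup>-\<^sup>j\<close> and all shifted factorials bounded, the general term of the
  double series is bounded by a product of a function of \<open>n\<close> and a function of \<open>j\<close>. The terms
  with \<open>j > n + k\<close>, for which the exponent would be truncated, vanish.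
\<close>

lemma double_series_bound:
  fixes q x y a b t :: complex
  assumes q: "norm q < 1" and \<rho>: "norm y < \<rho>"
  obtains K where "K \<ge> 0" "\<And>n j. norm (t ^ n / qpoch q q n * (q ^ (j choose 2) * qpoch a q j / qpoch q q j
            * ((- b) ^ j * qfalling q (n + k) j * cauchy_poly q (n + k - j) y x)))
       \<le> K * (\<rho> * norm t) ^ n * (norm q ^ (j choose 2) * (norm b / \<rho>) ^ j)"
proof -
  have \<rho>0: "\<rho> > 0" using \<rho> norm_ge_zero[of y] by linarith
  obtain M where M: "M > 0" "\<And>n. norm (cauchy_poly q n y x) \<le> M * \<rho> ^ n"
    using cauchy_poly_bounded[OF q \<rho>, where x = x] by blast
  obtain C where C: "C > 0" "\<And>n. norm (inverse (qpoch q q n)) \<le> C"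
    using qpoch_inverse_bounded[OF q q] by blast
  obtain P where P: "P > 0" "\<And>n. norm (qpoch q q n) \<le> P" using qpoch_bounded[OF q, where c = q] by blast
  obtain Q where Q: "Q > 0" "\<And>n. norm (qpoch a q n) \<le> Q" using qpoch_bounded[OF q, where c = a] by blast
  define K where "K = C * Q * C * (P * C) * M * \<rho> ^ k"
  have "norm (t ^ n / qpoch q q n * (q ^ (j choose 2) * qpoch a q j / qpoch q q j
            * ((- b) ^ j * qfalling q (n + k) j * cauchy_poly q (n + k - j) y x)))
       \<le> K * (\<rho> * norm t) ^ n * (norm q ^ (j choose 2) * (norm b / \<rho>) ^ j)" (is "?L \<le> ?R") for n j
  proof (cases "j \<le> n + k")
    case False
    then show ?thesis
      using \<rho>0 M C P Q by (simp add: qfalling_eq_0 K_def)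
  next
    case True
    have fall: "norm (qfalling q (n + k) j) \<le> P * C"
    proof -
      have "qfalling q (n + k) j = qpoch q q (n + k) * inverse (qpoch q q (n + k - j))"
        using qfalling_mult_qpoch[OF True, of q] qpoch_nonzero[OF q q, of "n + k - j"]
        by (simp add: field_simps)
      then show ?thesis
        using P C by (simp only: norm_mult) (intro mult_mono; simp)
    qed
    have "?L = norm t ^ n * norm (inverse (qpoch q q n)) * norm q ^ (j choose 2) * norm (qpoch a q j)
        * norm (inverse (qpoch q q j)) * norm b ^ j * norm (qfalling q (n + k) j)
        * norm (cauchy_poly q (n + k - j) y x)"
      by (simp add: norm_mult norm_divide norm_power norm_inverse divide_inverse mult_ac)
    also have "\<dots> \<le> norm t ^ n * C * norm q ^ (j choose 2) * Q * C * norm b ^ j * (P * C)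
        * (M * \<rho> ^ (n + k - j))"
      using C Q P M \<rho>0 fall by (intro mult_mono mult_nonneg_nonneg order_refl) auto
    also have "\<rho> ^ (n + k - j) = \<rho> ^ n * \<rho> ^ k / \<rho> ^ j"
      using True \<rho>0 by (simp add: power_diff power_add)
    finally show ?thesis
      using \<rho>0 by (simp add: K_def power_mult_distrib power_divide mult_ac)
  qed
  moreover have "K \<ge> 0" using C Q P M \<rho>0 by (simp add: K_def)
  ultimately show ?thesis using that by blast
qed

text \<open>
  The double series has the terms of the left-hand series as its row sums (\<open>gen_hahn_sums\<close>) and
  the terms of the operator series as its column sums (\<open>theta_iterate_sums\<close>).
\<close>

theorem gen_hahn_generating_function:
  fixes q x y a b t :: complex and k :: nat
  defines "F \<equiv> (\<lambda>u v. cauchy_poly q k v u * qpoch_inf (u * t) q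
                       / (qpoch (u * t) q k * qpoch_inf (v * t) q))"
  assumes q0: "q \<noteq> 0" and q: "norm q < 1" and yt: "norm (y * t) < 1"
    and xy: "\<And>m. m \<ge> 1 \<Longrightarrow> x \<noteq> q ^ m * y"
    and nz: "\<And>i. qpoch (inverse q ^ i * x * t) q k \<noteq> 0"
  shows "summable (\<lambda>n. gen_hahn q (n + k) x y a b * t ^ n / qpoch q q n)
       \<and> summable (L_term q a b F x y)
       \<and> (\<Sum>n. gen_hahn q (n + k) x y a b * t ^ n / qpoch q q n) = L_op q a b F x y"
proof -
  (* The points at which iterates of theta at (x, y) evaluate their argument. *)
  define D where "D = {(inverse q ^ i * x, q ^ j * y) | i j. True}"
  have D_shift: "(inverse q * u, v) \<in> D \<and> (u, q * v) \<in> D" if uvD: "(u, v) \<in> D" for u v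
  proof -
    obtain i j where "u = inverse q ^ i * x" "v = q ^ j * y" using uvD by (auto simp: D_def)
    then have "inverse q * u = inverse q ^ Suc i * x" "q * v = q ^ Suc j * y" by simp_all
    with \<open>u = _\<close> \<open>v = _\<close> show ?thesis unfolding D_def by blast
  qed
  have D_nz: "inverse q * u \<noteq> v" if uvD: "(u, v) \<in> D" for u v
  proof
    assume eq: "inverse q * u = v"
    obtain i j where uv: "u = inverse q ^ i * x" "v = q ^ j * y" using uvD by (auto simp: D_def)
    have "x = q ^ Suc i * (inverse q * u)"
      using q0 by (simp add: uv field_simps)
    also have "\<dots> = q ^ (Suc i + j) * y" unfolding eq by (simp only: uv power_add mult.assoc)
    finally show False using xy[of "Suc i + j"] by simp
  qed
  have F: "(\<lambda>n. t ^ n / qpoch q q n * cauchy_poly q (n + k) v u) sums F u v" if uvD: "(u, v) \<in> D" for u v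
  proof -
    obtain i j where uv: "u = inverse q ^ i * x" "v = q ^ j * y" using uvD by (auto simp: D_def)
    have "norm (v * t) = norm q ^ j * norm (y * t)" by (simp add: uv norm_mult norm_power mult_ac)
    also have "\<dots> \<le> 1 * norm (y * t)" using q by (intro mult_right_mono power_le_one) auto
    finally have "norm (v * t) < 1" using yt by simp
    then show ?thesis unfolding F_def
      using nz[of i] by (intro shifted_q_binomial_theorem q) (simp_all add: uv)
  qed
  have "(x, y) \<in> D" unfolding D_def by (auto intro!: exI[of _ 0])
  note iter = theta_iterate_sums[where d = "\<lambda>n. n + k" and D = D and b = b, OF q0 D_shift D_nz F this]
  define w where "w = (\<lambda>j. q ^ (j choose 2) * qpoch a q j / qpoch q q j)"
  define f where "f = (\<lambda>n j. t ^ n / qpoch q q n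
      * (w j * ((- b) ^ j * qfalling q (n + k) j * cauchy_poly q (n + k - j) y x)))"
  have rows: "f n sums (gen_hahn q (n + k) x y a b * t ^ n / qpoch q q n)" for n
    using sums_mult[OF gen_hahn_sums[OF q, of a b "n + k" y x], of "t ^ n / qpoch q q n"]
    by (simp add: f_def w_def mult_ac)
  have cols: "(\<lambda>n. f n j) sums L_term q a b F x y j" for j
  proof -
    have "(\<lambda>n. w j * (t ^ n / qpoch q q n * ((- b) ^ j * qfalling q (n + k) j
            * cauchy_poly q (n + k - j) y x))) sums L_term q a b F x y j"
      unfolding L_term_def w_def by (intro sums_mult iter)
    moreover have "w j * (t ^ n / qpoch q q n * ((- b) ^ j * qfalling q (n + k) j
            * cauchy_poly q (n + k - j) y x)) = f n j" for n
      unfolding f_def by (simp only: mult_ac)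
    ultimately show ?thesis by simp
  qed
  obtain \<rho> where \<rho>: "\<rho> > norm y" "\<rho> > 0" "\<rho> * norm t < 1" using rate_between[OF yt] by blast
  obtain K where K: "K \<ge> 0"
    "\<And>n j. norm (f n j) \<le> K * (\<rho> * norm t) ^ n * (norm q ^ (j choose 2) * (norm b / \<rho>) ^ j)"
    using double_series_bound[OF q \<rho>(1), of t a b k x] unfolding f_def w_def by blast
  have "summable (\<lambda>n. K * (\<rho> * norm t) ^ n)"
    using \<rho> by (intro summable_mult summable_geometric) auto
  moreover have "summable (\<lambda>j. norm q ^ (j choose 2) * (norm b / \<rho>) ^ j)"
    using q \<rho> by (intro summable_q_gauss) auto
  ultimately have "summable (\<lambda>n. gen_hahn q (n + k) x y a b * t ^ n / qpoch q q n)
       \<and> summable (L_term q a b F x y)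
       \<and> (\<Sum>n. gen_hahn q (n + k) x y a b * t ^ n / qpoch q q n) = suminf (L_term q a b F x y)"
    using \<rho> K by (intro sum_swap_dominated[OF K(2) _ _ _ _ rows cols]) auto
  then show ?thesis by (simp add: L_op_def)
qed

theorem theorem3p3:
  fixes q :: real and k :: nat and x y a b t :: complex
  defines "F \<equiv> (\<lambda>u v. cauchy_poly q k v u * qpoch_inf (u * t) q
                       / (qpoch (u * t) q k * qpoch_inf (v * t) q))"
  assumes "0 < q" and "q < 1"
    and "norm (y * t) < 1"
    and "\<And>m. m \<ge> 1 \<Longrightarrow> x \<noteq> q ^ m * y"
    and "\<And>i. qpoch (inverse q ^ i * x * t) q k \<noteq> 0"
  shows "summable (\<lambda>n. gen_hahn q (n + k) x y a b * t ^ n / qpoch q q n)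
       \<and> summable (L_term q a b F x y)
       \<and> (\<Sum>n. gen_hahn q (n + k) x y a b * t ^ n / qpoch q q n) = L_op q a b F x y"
  unfolding F_def
  using assms(2-) by (intro gen_hahn_generating_function) auto

end
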